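(* Let $X$ be a perfect paracompact space and let $E\subseteq X$ be a completely metrizable subspace of $X$. Then $E$ is an $H_1$-retract of $X$.
   Context: All topological spaces are assumed to be Hausdorff. A topological space is perfect if each of its open subsets is an $F_\sigma$-set (equivalently, each closed subset is a $G_\delta$-set). For topological spaces $X$ and $Y$, a mapping $f:X\to Y$ is of the first Lebesgue class (a Lebesgue class one mapping), written $f\in H_1(X,Y)$, if for every open set $V\subseteq Y$ the preimage $f^{-1}(V)$ is an $F_\sigma$-set in $X$. A subset $E$ of a topological space $X$ (with the subspace topology) is an $H_1$-retract of $X$ if there exists a mapping $r\in H_1(X,E)$ such that $r(x)=x$ for all $x\in E$. *)

theory Defs
  imports "HOL-Analysis.Analysis"
begin

text \<open>
  Separation axioms are not built into the following definitions; the Hausdorff property is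
  assumed separately where it is needed. The notion of perfectness defined here is unrelated to
  the type class \<open>perfect_space\<close> (spaces without isolated points).
\<close>

definition perfect_topology :: "'a topology \<Rightarrow> bool" where
  "perfect_topology X \<longleftrightarrow> (\<forall>U. openin X U \<longrightarrow> fsigma_in X U)"

definition paracompact_space :: "'a topology \<Rightarrow> bool" where
  "paracompact_space X \<longleftrightarrow>
     (\<forall>\<U>. (\<forall>U\<in>\<U>. openin X U) \<and> \<Union>\<U> = topspace X \<longrightarrow>
        (\<exists>\<V>. (\<forall>V\<in>\<V>. openin X V) \<and> \<Union>\<V> = topspace X \<and>
             (\<forall>V\<in>\<V>. \<exists>U\<in>\<U>. V \<subseteq> U) \<and> locally_finite_in X \<V>))"

definition Lebesgue_class_one :: "'a topology \<Rightarrow> 'b topology \<Rightarrow> ('a \<Rightarrow> 'b) set" where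
  "Lebesgue_class_one X Y =
     {f. f \<in> topspace X \<rightarrow> topspace Y \<and>
         (\<forall>V. openin Y V \<longrightarrow> fsigma_in X {x \<in> topspace X. f x \<in> V})}"

definition H1_retract_of :: "'a set \<Rightarrow> 'a topology \<Rightarrow> bool" (infix \<open>H1'_retract'_of\<close> 50) where
  "E H1_retract_of X \<longleftrightarrow>
     E \<subseteq> topspace X \<and> (\<exists>r \<in> Lebesgue_class_one X (subtopology X E). \<forall>x\<in>E. r x = x)"

end

theory Submission
  imports Defs
begin

text \<open>
  The retraction is a uniform limit of maps that are locally constant on each member of a
  countable closed cover. A map \<open>f\<close> of this kind is of the first Lebesgue class for a strong
  reason: the preimage of \<^emph>\<open>every\<close> set of values is an \<open>F\<^sub>\<sigma>\<close>-set. Moreover, unlike maps that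
  merely have the latter property, these maps are visibly closed under pairing
  (\<open>sigma_locally_constant_Pair\<close>) and hence under any rule that computes a value from two
  of them.

  Paracompactness and perfectness supply such maps. If open sets \<open>U i\<close> are given, there is a
  \<open>\<sigma>\<close>-locally constant map that assigns to each point \<open>x\<close> of their union an index \<open>i\<close> with
  \<open>x \<in> U i\<close> (\<open>open_family_selector\<close>). For a locally finite open cover one takes the least
  member containing \<open>x\<close> in some well-order: the points whose least member is \<open>V\<close> form an open
  set minus an open set, and perfectness exhausts the first of these by closed sets, with local
  finiteness making all unions over different \<open>V\<close> closed. The union of the \<open>U i\<close> is itself a
  countable union of closed sets, over each of which the family can be refined to a locally
  finite cover.

  Now let \<open>d\<close> be a complete metric on \<open>E\<close>. Applied to open sets of \<open>X\<close> that trace small balls on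
  \<open>E\<close>, selection yields maps \<open>\<phi> n\<close> from \<open>X\<close> to \<open>E\<close> that move the points of \<open>E\<close> by less than
  \<open>(1/2)^(n+2)\<close>. Outside \<open>E\<close> these maps need not converge. They are corrected to maps \<open>\<psi> n\<close>
  by accepting the value \<open>\<phi> (n+1) x\<close> only when it lies within \<open>(1/2)^n\<close> of \<open>\<psi> n x\<close>, and
  keeping \<open>\<psi> n x\<close> otherwise. This makes the sequence uniformly Cauchy on all of \<open>X\<close> and changes
  nothing on \<open>E\<close>. The limit exists by completeness, fixes \<open>E\<close> pointwise, and is of the first
  Lebesgue class because the convergence is uniform (\<open>uniform_limit_Lebesgue_class_one\<close>).
\<close>

section \<open>Maps that are locally constant on countably many closed pieces\<close>

text \<open>
  That the trace on \<open>K\<close> of every preimage is closed says that the restriction of \<open>f\<close> to the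
  closed set \<open>K\<close> is continuous into a discrete space; \<open>J = UNIV\<close> gives the closedness of \<open>K\<close>.
\<close>

definition sigma_locally_constant :: "'a topology \<Rightarrow> 'i set \<Rightarrow> ('a \<Rightarrow> 'i) \<Rightarrow> bool" where
  "sigma_locally_constant X I f \<longleftrightarrow>
     f \<in> topspace X \<rightarrow> I \<and>
     (\<exists>\<K>. countable \<K> \<and> \<Union>\<K> = topspace X \<and> (\<forall>K\<in>\<K>. \<forall>J. closedin X {x\<in>K. f x \<in> J}))"

lemma sigma_locally_constantI:
  assumes "countable \<K>" and "\<Union>\<K> = topspace X"
    and "\<And>K J. K \<in> \<K> \<Longrightarrow> closedin X {x\<in>K. f x \<in> J}"
    and "\<And>x. x \<in> topspace X \<Longrightarrow> f x \<in> I"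
  shows "sigma_locally_constant X I f"
  unfolding sigma_locally_constant_def using assms by (intro conjI exI[of _ \<K>]) auto

lemma sigma_locally_constantE:
  assumes "sigma_locally_constant X I f"
  obtains \<K> where "countable \<K>" and "\<Union>\<K> = topspace X"
    and "\<forall>K\<in>\<K>. \<forall>J. closedin X {x\<in>K. f x \<in> J}"
proof -
  from assms have "\<exists>\<K>. countable \<K> \<and> \<Union>\<K> = topspace X \<and>
      (\<forall>K\<in>\<K>. \<forall>J. closedin X {x\<in>K. f x \<in> J})"
    unfolding sigma_locally_constant_def by (rule conjunct2)
  then show thesis
    by (elim exE conjE) (rule that)
qed

lemma sigma_locally_constant_in:
  assumes "sigma_locally_constant X I f" and "x \<in> topspace X"
  shows "f x \<in> I"
  using assms unfolding sigma_locally_constant_def by (meson PiE)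

lemma sigma_locally_constant_const:
  assumes "i \<in> I"
  shows "sigma_locally_constant X I (\<lambda>_. i)"
proof (rule sigma_locally_constantI[of "{topspace X}"])
  show "closedin X {x \<in> K. i \<in> J}" if "K \<in> {topspace X}" for K J
    using that by (cases "i \<in> J") auto
qed (use assms in auto)

lemma sigma_locally_constant_compose:
  assumes "sigma_locally_constant X I f" and "h \<in> I \<rightarrow> I'"
  shows "sigma_locally_constant X I' (\<lambda>x. h (f x))"
proof -
  obtain \<K> where \<K>: "countable \<K>" "\<Union>\<K> = topspace X"
    "\<forall>K\<in>\<K>. \<forall>J. closedin X {x\<in>K. f x \<in> J}"
    by (rule sigma_locally_constantE[OF assms(1)])
  have "closedin X {x\<in>K. h (f x) \<in> J}" if "K \<in> \<K>" for K J
    using \<K>(3)[rule_format, OF that, of "h -` J"] by simp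
  moreover have "h (f x) \<in> I'" if "x \<in> topspace X" for x
    using sigma_locally_constant_in[OF assms(1) that] assms(2) by auto
  ultimately show ?thesis
    by (rule sigma_locally_constantI[OF \<K>(1,2)])
qed

text \<open>
  On the intersection of a piece for \<open>f\<close> and a piece for \<open>g\<close> both maps are locally constant, and
  so is the pair. The corresponding statement for maps whose preimages are all \<open>F\<^sub>\<sigma>\<close> would involve
  a possibly uncountable union over the values of \<open>f\<close>; this is why the pieces are part of the
  definition.
\<close>

lemma sigma_locally_constant_Pair:
  assumes "sigma_locally_constant X I f" and "sigma_locally_constant X J g"
  shows "sigma_locally_constant X (I \<times> J) (\<lambda>x. (f x, g x))"
proof -
  obtain \<K> where \<K>: "countable \<K>" "\<Union>\<K> = topspace X"
    "\<forall>K\<in>\<K>. \<forall>A. closedin X {x\<in>K. f x \<in> A}"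
    by (rule sigma_locally_constantE[OF assms(1)])
  obtain \<L> where \<L>: "countable \<L>" "\<Union>\<L> = topspace X"
    "\<forall>L\<in>\<L>. \<forall>B. closedin X {x\<in>L. g x \<in> B}"
    by (rule sigma_locally_constantE[OF assms(2)])
  let ?\<M> = "(\<lambda>(K,L). K \<inter> L) ` (\<K> \<times> \<L>)"
  have "closedin X {x\<in>K \<inter> L. (f x, g x) \<in> A}" if K: "K \<in> \<K>" and L: "L \<in> \<L>" for K L A
  proof -
    have locally_determined: "\<exists>V. openin X V \<and> x \<in> V \<and>
        (\<forall>y\<in>V \<inter> (K \<inter> L). f y = f x \<and> g y = g x)" if x: "x \<in> K \<inter> L" for x
    proof -
      let ?V = "topspace X - ({y\<in>K. f y \<in> - {f x}} \<union> {y\<in>L. g y \<in> - {g x}})"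
      have "openin X ?V"
        by (intro openin_diff openin_topspace closedin_Un
            \<K>(3)[rule_format, OF K] \<L>(3)[rule_format, OF L])
      moreover have "x \<in> ?V"
        using x K \<K>(2) by auto
      ultimately show ?thesis
        by (intro exI[of _ ?V]) auto
    qed
    have KL: "closedin X (K \<inter> L)"
      using \<K>(3)[rule_format, OF K, of UNIV] \<L>(3)[rule_format, OF L, of UNIV]
      by (simp add: closedin_Int)
    have "openin X (topspace X - {x\<in>K \<inter> L. (f x, g x) \<in> A})"
    proof (subst openin_subopen, intro ballI)
      fix x assume x: "x \<in> topspace X - {x\<in>K \<inter> L. (f x, g x) \<in> A}"
      show "\<exists>T. openin X T \<and> x \<in> T \<and> T \<subseteq> topspace X - {x\<in>K \<inter> L. (f x, g x) \<in> A}"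
      proof (cases "x \<in> K \<inter> L")
        case True
        from locally_determined[OF this] obtain V where
          V: "openin X V" "x \<in> V" "\<forall>y\<in>V \<inter> (K \<inter> L). f y = f x \<and> g y = g x"
          by (elim exE conjE) (rule that)
        have "V \<subseteq> topspace X - {x\<in>K \<inter> L. (f x, g x) \<in> A}"
        proof
          fix y assume y: "y \<in> V"
          then have "y \<in> topspace X" using openin_subset[OF V(1)] by auto
          moreover have "(f y, g y) \<notin> A" if "y \<in> K \<inter> L"
          proof -
            have "(f y, g y) = (f x, g x)" using V(3) y that by simp
            then show ?thesis using x True by simp
          qed
          ultimately show "y \<in> topspace X - {x\<in>K \<inter> L. (f x, g x) \<in> A}" by auto
        qed
        then show ?thesis
          using V(1,2) by (intro exI[of _ V]) simp
      next
        case False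
        then show ?thesis
          using x KL by (intro exI[of _ "topspace X - K \<inter> L"]) auto
      qed
    qed
    moreover have "{x\<in>K \<inter> L. (f x, g x) \<in> A} \<subseteq> topspace X"
      using K \<K>(2) by auto
    ultimately show ?thesis
      by (simp add: closedin_def)
  qed
  moreover have "countable ?\<M>"
    using \<K>(1) \<L>(1) by simp
  moreover have "\<Union>?\<M> = \<Union>\<K> \<inter> \<Union>\<L>"
    by auto
  then have "\<Union>?\<M> = topspace X"
    using \<K>(2) \<L>(2) by simp
  moreover have "(f x, g x) \<in> I \<times> J" if "x \<in> topspace X" for x
    using sigma_locally_constant_in[OF assms(1) that] sigma_locally_constant_in[OF assms(2) that]
    by simp
  ultimately show ?thesis
    by (intro sigma_locally_constantI[of ?\<M>]) auto
qed

lemma fsigma_in_sigma_locally_constant_vimage: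
  assumes "sigma_locally_constant X I f"
  shows "fsigma_in X {x \<in> topspace X. f x \<in> J}"
proof -
  obtain \<K> where \<K>: "countable \<K>" "\<Union>\<K> = topspace X"
    "\<forall>K\<in>\<K>. \<forall>J. closedin X {x\<in>K. f x \<in> J}"
    by (rule sigma_locally_constantE[OF assms])
  have "fsigma_in X (\<Union>K\<in>\<K>. {x\<in>K. f x \<in> J})"
    using \<K>(1,3) by (intro fsigma_in_Union) (auto intro: closed_imp_fsigma_in)
  moreover have "(\<Union>K\<in>\<K>. {x\<in>K. f x \<in> J}) = {x \<in> topspace X. f x \<in> J}"
    using \<K>(2) by auto
  ultimately show ?thesis by simp
qed

section \<open>Selecting members of open families\<close>

lemma perfect_topology_open_as_closed_Union:
  assumes "perfect_topology X" and "openin X U"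
  shows "\<exists>C. (\<forall>n::nat. closedin X (C n)) \<and> (\<Union>n. C n) = U"
proof -
  have "fsigma_in X U"
    using assms unfolding perfect_topology_def by simp
  then obtain C where "\<forall>n::nat. closedin X (C n)" "(\<Union>n. C n) = U"
    unfolding fsigma_in_ascending by auto
  then show ?thesis by auto
qed

text \<open>
  The selector picks the least member of \<open>\<V>\<close> containing the point, for some well-order of all
  sets. With every \<open>V\<close> written as the union of closed sets \<open>C V n\<close>, the \<open>n\<close>-th piece consists of the
  points that lie in the \<open>n\<close>-th closed part of their own least member. The preimage of \<open>V\<close> in this
  piece is \<open>C V n\<close> minus the smaller members, hence closed, and these preimages are locally finite
  because they shrink the members of \<open>\<V>\<close>.
\<close>

lemma locally_finite_open_cover_selector:
  assumes X: "perfect_topology X"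
    and \<V>: "\<forall>V\<in>\<V>. openin X V" "\<Union>\<V> = topspace X" "locally_finite_in X \<V>"
  shows "\<exists>s. sigma_locally_constant X \<V> s \<and> (\<forall>x\<in>topspace X. x \<in> s x)"
proof -
  have "\<forall>V\<in>\<V>. \<exists>C. (\<forall>n::nat. closedin X (C n)) \<and> (\<Union>n. C n) = V"
    by (intro ballI perfect_topology_open_as_closed_Union[OF X bspec[OF \<V>(1)]])
  from bchoice[OF this] obtain C
    where C': "\<forall>V\<in>\<V>. (\<forall>n::nat. closedin X (C V n)) \<and> (\<Union>n. C V n) = V" ..
  have C: "\<And>V n. V \<in> \<V> \<Longrightarrow> closedin X (C V n)" "\<And>V. V \<in> \<V> \<Longrightarrow> (\<Union>n. C V n) = V"
    using C' by simp_all
  obtain r :: "'a set rel" where r: "Well_order r" "Field r = UNIV"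
    using well_ordering by (elim exE conjE) (rule that)
  have wf: "wf (r - Id)" and tot: "\<And>V W. (V,W) \<in> r \<or> (W,V) \<in> r"
    using r by (auto simp: well_order_on_def linear_order_on_def partial_order_on_def
        preorder_on_def total_on_def refl_on_def) metis
  define first where "first x V \<longleftrightarrow> V \<in> \<V> \<and> x \<in> V \<and> (\<forall>W\<in>\<V>. (W,V) \<in> r - Id \<longrightarrow> x \<notin> W)" for x V
  have ex_first: "\<exists>V. first x V" if "x \<in> topspace X" for x
  proof -
    have "x \<in> \<Union>\<V>" using that \<V>(2) by simp
    then obtain V0 where "V0 \<in> {V\<in>\<V>. x \<in> V}" by blast
    from wfE_min[OF wf this] obtain V where "V \<in> {V\<in>\<V>. x \<in> V}"
      "\<And>W. (W,V) \<in> r - Id \<Longrightarrow> W \<notin> {V\<in>\<V>. x \<in> V}" by blast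
    then show ?thesis unfolding first_def by blast
  qed
  have first_unique: "V = W" if "first x V" "first x W" for x V W
    using that tot[of V W] unfolding first_def by auto
  define s where "s x = (SOME V. first x V)" for x
  have s: "first x (s x)" if "x \<in> topspace X" for x
    unfolding s_def using someI_ex[OF ex_first[OF that]] .
  define D where "D n V = C V n - \<Union>{W\<in>\<V>. (W,V) \<in> r - Id}" for n V
  define K where "K n = {x\<in>topspace X. x \<in> C (s x) n}" for n
  have CV: "C V n \<subseteq> V" if "V \<in> \<V>" for V n
    using C(2)[OF that] by blast
  have "closedin X {x\<in>K n. s x \<in> J}" for n J
  proof -
    have "openin X (\<Union>{W\<in>\<V>. (W,V) \<in> r - Id})" for V
      using \<V>(1) by blast
    then have "closedin X (D n V)" if "V \<in> \<V>" for V
      unfolding D_def using C(1)[OF that] by blast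
    moreover have "locally_finite_in X (D n ` (\<V> \<inter> J))"
      using CV by (intro locally_finite_in_refinement locally_finite_in_subset[OF \<V>(3)])
        (auto simp: D_def)
    ultimately have "closedin X (\<Union>(D n ` (\<V> \<inter> J)))"
      by (intro closedin_locally_finite_Union) auto
    moreover have "{x\<in>K n. s x \<in> J} = \<Union>(D n ` (\<V> \<inter> J))"
    proof (intro equalityI subsetI)
      fix x assume "x \<in> {x\<in>K n. s x \<in> J}"
      then show "x \<in> \<Union>(D n ` (\<V> \<inter> J))"
        using s[of x] unfolding K_def D_def first_def by blast
    next
      fix x assume "x \<in> \<Union>(D n ` (\<V> \<inter> J))"
      then obtain V where V: "V \<in> \<V>" "V \<in> J" "x \<in> C V n" "first x V"
        unfolding D_def first_def using CV by blast
      then have "x \<in> topspace X" "s x = V"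
        using \<V>(2) s[of x] first_unique unfolding first_def by blast+
      then show "x \<in> {x\<in>K n. s x \<in> J}"
        using V unfolding K_def by auto
    qed
    ultimately show ?thesis by simp
  qed
  moreover have "\<Union>(range K) = topspace X"
    using s C(2) unfolding K_def first_def by blast
  moreover have "s x \<in> \<V>" if "x \<in> topspace X" for x
    using s[OF that] unfolding first_def by blast
  ultimately have "sigma_locally_constant X \<V> s"
    by (intro sigma_locally_constantI[of "range K"]) auto
  moreover have "\<forall>x\<in>topspace X. x \<in> s x"
    using s unfolding first_def by simp
  ultimately show ?thesis by (intro exI[of _ s] conjI)
qed

text \<open>
  Adding the complement of \<open>L\<close> turns the family into an open cover of the whole space, to which
  paracompactness applies. A member of the refinement that meets \<open>L\<close> cannot lie in the added
  set, so it lies in some \<open>U i\<close>.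
\<close>

lemma closed_set_selector:
  assumes X: "perfect_topology X" "paracompact_space X"
    and U: "\<forall>i\<in>I. openin X (U i)"
    and "I \<noteq> {}" and L: "closedin X L" "L \<subseteq> (\<Union>i\<in>I. U i)"
  shows "\<exists>f. sigma_locally_constant X I f \<and> (\<forall>x\<in>L. x \<in> U (f x))"
proof -
  obtain i0 where i0: "i0 \<in> I" using \<open>I \<noteq> {}\<close> by blast
  let ?\<W> = "insert (topspace X - L) (U ` I)"
  have "\<forall>W\<in>?\<W>. openin X W"
    using U L(1) by auto
  moreover have "(\<Union>i\<in>I. U i) \<subseteq> topspace X"
    using U by (intro UN_least openin_subset) simp
  then have "\<Union>?\<W> = topspace X"
    using L(2) by auto
  ultimately have "\<forall>W\<in>?\<W>. openin X W" "\<Union>?\<W> = topspace X" .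
  from X(2)[unfolded paracompact_space_def, THEN spec, THEN mp, OF conjI, OF this]
  obtain \<V> where \<V>: "\<forall>V\<in>\<V>. openin X V" "\<Union>\<V> = topspace X" "locally_finite_in X \<V>"
    and ref: "\<forall>V\<in>\<V>. \<exists>W\<in>?\<W>. V \<subseteq> W"
    by (elim exE conjE) (rule that)
  from locally_finite_open_cover_selector[OF X(1) \<V>]
  obtain s where s: "sigma_locally_constant X \<V> s" "\<forall>x\<in>topspace X. x \<in> s x"
    by (elim exE conjE) (rule that)
  \<comment> \<open>For \<open>V\<close> inside no \<open>U j\<close> the index is arbitrary; this occurs only away from \<open>L\<close>.\<close>
  have "\<forall>V. \<exists>i. i \<in> I \<and> ((\<exists>j\<in>I. V \<subseteq> U j) \<longrightarrow> V \<subseteq> U i)"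
    using i0 by blast
  from choice[OF this] obtain h
    where h: "\<forall>V. h V \<in> I \<and> ((\<exists>j\<in>I. V \<subseteq> U j) \<longrightarrow> V \<subseteq> U (h V))" ..
  have "x \<in> U (h (s x))" if x: "x \<in> L" for x
  proof -
    have "x \<in> topspace X" using x L(1) closedin_subset by blast
    then have "x \<in> s x" "s x \<in> \<V>"
      using s(2) sigma_locally_constant_in[OF s(1)] by auto
    from bspec[OF ref this(2)] obtain W where W: "W \<in> ?\<W>" "s x \<subseteq> W" ..
    then have "W \<noteq> topspace X - L"
      using x \<open>x \<in> s x\<close> by auto
    then have "\<exists>j\<in>I. s x \<subseteq> U j"
      using W by auto
    then have "s x \<subseteq> U (h (s x))"
      using h by simp
    then show ?thesis using \<open>x \<in> s x\<close> by auto
  qed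
  moreover have "sigma_locally_constant X I (\<lambda>x. h (s x))"
    using h by (intro sigma_locally_constant_compose[OF s(1)]) simp
  ultimately show ?thesis by (intro exI[of _ "\<lambda>x. h (s x)"]) simp
qed

text \<open>
  At each point the map with the least admissible index is used. The set where this index is \<open>n\<close>
  is the closed set \<open>L n\<close> intersected with the complement of the earlier ones; that complement is
  open, so perfectness cuts it into countably many closed pieces.
\<close>

lemma sigma_locally_constant_glue:
  assumes X: "perfect_topology X"
    and L: "\<And>n::nat. closedin X (L n)" "(\<Union>n. L n) = topspace X"
    and f: "\<And>n. sigma_locally_constant X I (f n)"
  shows "\<exists>g. sigma_locally_constant X I g \<and> (\<forall>x\<in>topspace X. \<exists>n. x \<in> L n \<and> g x = f n x)"
proof -
  have "\<forall>n. \<exists>\<K>. countable \<K> \<and> \<Union>\<K> = topspace X \<and>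
      (\<forall>K\<in>\<K>. \<forall>J. closedin X {x\<in>K. f n x \<in> J})"
    using f unfolding sigma_locally_constant_def by simp
  from choice[OF this] obtain \<K> where
    "\<forall>n. countable (\<K> n) \<and> \<Union>(\<K> n) = topspace X \<and>
      (\<forall>K\<in>\<K> n. \<forall>J. closedin X {x\<in>K. f n x \<in> J})" ..
  then have \<K>: "\<And>n. countable (\<K> n)" "\<And>n. \<Union>(\<K> n) = topspace X"
    "\<And>n. \<forall>K\<in>\<K> n. \<forall>J. closedin X {x\<in>K. f n x \<in> J}"
    by simp_all
  have "openin X (topspace X - (\<Union>m<n. L m))" for n
    using L(1) by (intro openin_diff closedin_Union) auto
  then have "\<forall>n. \<exists>C. (\<forall>j::nat. closedin X (C j)) \<and> (\<Union>j. C j) = topspace X - (\<Union>m<n. L m)"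
    by (intro allI perfect_topology_open_as_closed_Union[OF X])
  from choice[OF this] obtain C where
    "\<forall>n. (\<forall>j::nat. closedin X (C n j)) \<and> (\<Union>j. C n j) = topspace X - (\<Union>m<n. L m)" ..
  then have C: "\<And>n j. closedin X (C n j)" "\<And>n. (\<Union>j. C n j) = topspace X - (\<Union>m<n. L m)"
    by simp_all
  define k where "k x = (LEAST n. x \<in> L n)" for x
  have k: "x \<in> L (k x)" if "x \<in> topspace X" for x
    unfolding k_def using that L(2) by (metis LeastI UN_E)
  have k_eq: "k x = n" if "x \<in> L n" "x \<in> C n j" for x n j
    unfolding k_def
  proof (rule Least_equality)
    show "x \<in> L n" by fact
    fix m assume "x \<in> L m"
    moreover have "x \<notin> (\<Union>m<n. L m)" using C(2)[of n] that(2) by auto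
    ultimately show "n \<le> m" by (auto simp: not_less[symmetric])
  qed
  have C_ex: "\<exists>j. x \<in> C (k x) j" if "x \<in> topspace X" for x
  proof -
    have "x \<notin> L m" if "m < k x" for m
      using not_less_Least[of m "\<lambda>n. x \<in> L n"] that unfolding k_def by blast
    then show ?thesis using C(2)[of "k x"] that by blast
  qed
  define g where "g x = f (k x) x" for x
  let ?\<M> = "\<Union>n. \<Union>j. (\<lambda>K. K \<inter> (L n \<inter> C n j)) ` \<K> n"
  have "closedin X {x \<in> K \<inter> (L n \<inter> C n j). g x \<in> J}" if "K \<in> \<K> n" for K n j J
  proof -
    have "{x \<in> K \<inter> (L n \<inter> C n j). g x \<in> J} = {x\<in>K. f n x \<in> J} \<inter> (L n \<inter> C n j)"
      using k_eq unfolding g_def by auto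
    then show ?thesis using \<K>(3)[of n] that L(1) C(1) by (simp add: closedin_Int)
  qed
  moreover have "\<Union>?\<M> = topspace X"
  proof (intro equalityI subsetI)
    fix x assume "x \<in> \<Union>?\<M>"
    then show "x \<in> topspace X" using \<K>(2) by blast
  next
    fix x assume x: "x \<in> topspace X"
    then obtain K j where "K \<in> \<K> (k x)" "x \<in> K" "x \<in> C (k x) j"
      using \<K>(2)[of "k x"] C_ex by blast
    then show "x \<in> \<Union>?\<M>" using k[OF x] by blast
  qed
  moreover have "countable ?\<M>"
    using \<K>(1) by auto
  moreover have "g x \<in> I" if "x \<in> topspace X" for x
    using sigma_locally_constant_in[OF f that] unfolding g_def .
  ultimately have "sigma_locally_constant X I g"
    by (intro sigma_locally_constantI[of ?\<M>]) auto
  moreover have "\<forall>x\<in>topspace X. \<exists>n. x \<in> L n \<and> g x = f n x"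
    using k by (auto simp: g_def)
  ultimately show ?thesis by (intro exI[of _ g] conjI)
qed

text \<open>
  The union of the family is a countable union of closed sets, on each of which
  \<open>closed_set_selector\<close> applies; the remaining points form one more closed set, on which any constant
  will do. Thus the selection is total although the family need not cover the space.
\<close>

lemma open_family_selector:
  assumes X: "perfect_topology X" "paracompact_space X"
    and U: "\<forall>i\<in>I. openin X (U i)" and "I \<noteq> {}"
  shows "\<exists>f. sigma_locally_constant X I f \<and> (\<forall>x\<in>(\<Union>i\<in>I. U i). x \<in> U (f x))"
proof -
  let ?G = "\<Union>i\<in>I. U i"
  have G: "openin X ?G" using U by (intro openin_Union) auto
  from perfect_topology_open_as_closed_Union[OF X(1) this]
  obtain C where C: "\<forall>n::nat. closedin X (C n)" "(\<Union>n. C n) = ?G"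
    by (elim exE conjE) (rule that)
  define L where "L n = (case n of 0 \<Rightarrow> topspace X - ?G | Suc m \<Rightarrow> C m)" for n
  have L: "closedin X (L n)" for n
    using G C(1) by (auto simp: L_def split: nat.split)
  have "(\<Union>n. L n) = L 0 \<union> (\<Union>n. L (Suc n))"
    by (metis UNIV_nat_eq UN_insert image_image)
  also have "\<dots> = topspace X"
    using C(2) openin_subset[OF G] by (auto simp: L_def)
  finally have L_cover: "(\<Union>n. L n) = topspace X" .
  have "\<exists>f. sigma_locally_constant X I f \<and> (\<forall>x \<in> L n \<inter> ?G. x \<in> U (f x))" for n
  proof (cases n)
    case 0
    obtain i where "i \<in> I" using \<open>I \<noteq> {}\<close> by auto
    then show ?thesis
      using sigma_locally_constant_const[of i I X] 0
      by (intro exI[of _ "\<lambda>_. i"]) (auto simp: L_def)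
  next
    case (Suc m)
    have "L n \<subseteq> ?G" using Suc C(2) by (auto simp: L_def)
    from closed_set_selector[OF X U \<open>I \<noteq> {}\<close> L this]
    show ?thesis by (elim exE conjE) (rule exI, auto)
  qed
  then have "\<forall>n. \<exists>f. sigma_locally_constant X I f \<and> (\<forall>x \<in> L n \<inter> ?G. x \<in> U (f x))" ..
  from choice[OF this] obtain f where
    f: "\<forall>n. sigma_locally_constant X I (f n) \<and> (\<forall>x \<in> L n \<inter> ?G. x \<in> U (f n x))" ..
  have "sigma_locally_constant X I (f n)" for n
    using f by simp
  from sigma_locally_constant_glue[where f = f, OF X(1) L L_cover this]
  obtain g where g: "sigma_locally_constant X I g"
    "\<forall>x\<in>topspace X. \<exists>n. x \<in> L n \<and> g x = f n x"
    by (elim exE conjE) (rule that)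
  have "x \<in> U (g x)" if x: "x \<in> ?G" for x
  proof -
    obtain n where n: "x \<in> L n" "g x = f n x"
      using g(2) x openin_subset[OF G] by (meson subsetD)
    have "x \<in> U (f n x)"
      using f[rule_format, THEN conjunct2] n(1) x by simp
    then show ?thesis using n(2) by simp
  qed
  then show ?thesis using g(1) by (intro exI[of _ g]) simp
qed

section \<open>Uniform limits and the retraction\<close>

text \<open>
  The hypothesis \<open>close\<close> forces \<open>\<psi> n x\<close> within \<open>2 * (1/2)^n\<close> of the limit \<open>r x\<close>, uniformly in \<open>x\<close>. Hence
  \<open>r x\<close> lies in an open set \<open>V\<close> exactly when, for some \<open>n\<close>, the closed ball of that radius around
  \<open>\<psi> n x\<close> is contained in \<open>V\<close>. For each \<open>n\<close> the latter is a condition on the value \<open>\<psi> n x\<close> alone,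
  so it defines an \<open>F\<^sub>\<sigma>\<close>-set.
\<close>

lemma (in Metric_space) uniform_limit_Lebesgue_class_one:
  assumes "mcomplete"
    and \<psi>: "\<And>n. sigma_locally_constant X M (\<psi> n)"
    and close: "\<And>n x. x \<in> topspace X \<Longrightarrow> d (\<psi> n x) (\<psi> (Suc n) x) \<le> (1/2)^n"
  shows "\<exists>r \<in> Lebesgue_class_one X mtopology.
    \<forall>x\<in>topspace X. limitin mtopology (\<lambda>n. \<psi> n x) (r x) sequentially"
proof -
  have \<psi>M: "\<psi> n x \<in> M" if "x \<in> topspace X" for n x
    using sigma_locally_constant_in[OF \<psi> that] .
  \<comment> \<open>The subtracted term lets the geometric series estimate go through by induction.\<close>
  have tail: "d (\<psi> n x) (\<psi> (n + k) x) \<le> 2 * (1/2)^n - 2 * (1/2)^(n + k)"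
    if x: "x \<in> topspace X" for n k x
  proof (induction k)
    case 0
    then show ?case using \<psi>M[OF x] by simp
  next
    case (Suc k)
    have "d (\<psi> n x) (\<psi> (n + Suc k) x) \<le> d (\<psi> n x) (\<psi> (n + k) x) + d (\<psi> (n + k) x) (\<psi> (n + Suc k) x)"
      using triangle \<psi>M[OF x] by blast
    then show ?case using Suc close[OF x, of "n + k"] by simp
  qed
  have tail': "d (\<psi> n x) (\<psi> m x) \<le> 2 * (1/2)^n" if x: "x \<in> topspace X" and "n \<le> m" for n m x
    using tail[OF x, of n "m - n"] \<open>n \<le> m\<close> by (simp add: order_trans)
  have small: "\<exists>N. \<forall>n\<ge>N. c * (1/2)^n < \<epsilon>" if "\<epsilon> > 0" for c \<epsilon> :: real
  proof -
    have "(\<lambda>n. c * (1/2)^n) \<longlonglongrightarrow> c * 0"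
      by (intro tendsto_mult_left LIMSEQ_power_zero) auto
    then show ?thesis
      using order_tendstoD(2)[of _ "c * 0" sequentially \<epsilon>] that
      by (simp add: eventually_sequentially)
  qed
  have "\<exists>y. limitin mtopology (\<lambda>n. \<psi> n x) y sequentially" if x: "x \<in> topspace X" for x
  proof -
    have "MCauchy (\<lambda>n. \<psi> n x)"
      unfolding MCauchy_def
    proof (intro conjI allI impI)
      show "range (\<lambda>n. \<psi> n x) \<subseteq> M" using \<psi>M[OF x] by auto
      fix \<epsilon> :: real assume "\<epsilon> > 0"
      then obtain N where N: "4 * (1/2)^N < \<epsilon>" using small by blast
      have "d (\<psi> n x) (\<psi> m x) < \<epsilon>" if "N \<le> n" "N \<le> m" for n m
        using tail'[OF x that(1)] tail'[OF x that(2)] N triangle[of "\<psi> n x" "\<psi> N x" "\<psi> m x"] \<psi>M[OF x]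
        by (simp add: commute)
      then show "\<exists>N. \<forall>n n'. N \<le> n \<longrightarrow> N \<le> n' \<longrightarrow> d (\<psi> n x) (\<psi> n' x) < \<epsilon>" by blast
    qed
    then show ?thesis using \<open>mcomplete\<close> unfolding mcomplete_def by blast
  qed
  then obtain r where r: "\<And>x. x \<in> topspace X \<Longrightarrow> limitin mtopology (\<lambda>n. \<psi> n x) (r x) sequentially"
    by metis
  have rM: "r x \<in> M" if "x \<in> topspace X" for x
    using r[OF that] limitin_mspace by blast
  have rate: "d (\<psi> n x) (r x) \<le> 2 * (1/2)^n" if x: "x \<in> topspace X" for n x
  proof (rule field_le_epsilon)
    fix \<epsilon> :: real assume "\<epsilon> > 0"
    then obtain N where N: "\<And>m. m \<ge> N \<Longrightarrow> d (\<psi> m x) (r x) < \<epsilon>"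
      using r[OF x] unfolding limitin_metric eventually_sequentially by blast
    show "d (\<psi> n x) (r x) \<le> 2 * (1/2)^n + \<epsilon>"
      using N[of "max n N"] tail'[OF x, of n "max n N"] \<psi>M[OF x] rM[OF x]
        triangle[of "\<psi> n x" "\<psi> (max n N) x" "r x"] by simp
  qed
  have "fsigma_in X {x \<in> topspace X. r x \<in> V}" if V: "openin mtopology V" for V
  proof -
    define J where "J n = {y\<in>M. mcball y (2 * (1/2)^n) \<subseteq> V}" for n :: nat
    have "{x \<in> topspace X. r x \<in> V} = (\<Union>n. {x \<in> topspace X. \<psi> n x \<in> J n})"
    proof (intro equalityI subsetI)
      fix x assume "x \<in> {x \<in> topspace X. r x \<in> V}"
      then have x: "x \<in> topspace X" and "r x \<in> V" by auto
      then obtain \<epsilon> where \<epsilon>: "\<epsilon> > 0" "mball (r x) \<epsilon> \<subseteq> V"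
        using V unfolding openin_mtopology by blast
      obtain n :: nat where n: "4 * (1/2)^n < \<epsilon>" using small[OF \<epsilon>(1)] by blast
      have "z \<in> mball (r x) \<epsilon>" if "z \<in> mcball (\<psi> n x) (2 * (1/2)^n)" for z
        using that rate[OF x, of n] n triangle[of "r x" "\<psi> n x" z] rM[OF x] \<psi>M[OF x]
        by (simp add: commute)
      then show "x \<in> (\<Union>n. {x \<in> topspace X. \<psi> n x \<in> J n})"
        using \<epsilon>(2) x \<psi>M[OF x] unfolding J_def by blast
    next
      fix x assume "x \<in> (\<Union>n. {x \<in> topspace X. \<psi> n x \<in> J n})"
      then obtain n where x: "x \<in> topspace X" and "mcball (\<psi> n x) (2 * (1/2)^n) \<subseteq> V"
        unfolding J_def by blast
      then show "x \<in> {x \<in> topspace X. r x \<in> V}"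
        using rate[OF x, of n] \<psi>M[OF x] rM[OF x] by (auto simp: subset_iff)
    qed
    then show ?thesis
      using fsigma_in_sigma_locally_constant_vimage[OF \<psi>] by (auto intro!: fsigma_in_Union)
  qed
  then have "r \<in> Lebesgue_class_one X mtopology"
    unfolding Lebesgue_class_one_def using rM by auto
  then show ?thesis using r by (intro bexI[of _ r]) auto
qed

theorem theorem3p2:
  fixes X :: "'a topology" and E :: "'a set"
  assumes "Hausdorff_space X"
    and "perfect_topology X"
    and "paracompact_space X"
    and "E \<subseteq> topspace X"
    and "E \<noteq> {}"
    and "completely_metrizable_space (subtopology X E)"
  shows "E H1_retract_of X"
proof -
  obtain M d where "Metric_space M d" and complete: "Metric_space.mcomplete M d"
    and top: "subtopology X E = Metric_space.mtopology M d"
    using assms(6) unfolding completely_metrizable_space_def by blast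
  interpret Metric_space M d by fact
  have ME: "M = E"
    using top topspace_mtopology assms(4) by (metis topspace_subtopology_subset)
  have approximation: "\<exists>\<phi>. sigma_locally_constant X M \<phi> \<and> (\<forall>x\<in>E. d x (\<phi> x) < (1/2)^(n+2))" for n
  proof -
    have "\<forall>y. \<exists>U. openin X U \<and> U \<inter> E = mball y ((1/2)^(n+2))"
    proof
      fix y
      have "openin (subtopology X E) (mball y ((1/2)^(n+2)))"
        unfolding top by (rule openin_mball)
      then show "\<exists>U. openin X U \<and> U \<inter> E = mball y ((1/2)^(n+2))"
        unfolding openin_subtopology by auto
    qed
    from choice[OF this] obtain U where
      U: "\<forall>y. openin X (U y) \<and> U y \<inter> E = mball y ((1/2)^(n+2))" ..
    have "M \<noteq> {}" using assms(5) ME by simp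
    from open_family_selector[where U = U, OF assms(2,3) _ this] U
    have "\<exists>\<phi>. sigma_locally_constant X M \<phi> \<and> (\<forall>x\<in>(\<Union>y\<in>M. U y). x \<in> U (\<phi> x))"
      by simp
    then obtain \<phi> where \<phi>: "sigma_locally_constant X M \<phi>" "\<forall>x\<in>(\<Union>y\<in>M. U y). x \<in> U (\<phi> x)"
      by (elim exE conjE) (rule that)
    have U_ball: "U y \<inter> E = mball y ((1/2)^(n+2))" for y
      using U by simp
    have "d x (\<phi> x) < (1/2)^(n+2)" if x: "x \<in> E" for x
    proof -
      have "x \<in> mball x ((1/2)^(n+2))" using x unfolding ME[symmetric] by simp
      then have "x \<in> U x" unfolding U_ball[symmetric] by simp
      then have "x \<in> U (\<phi> x) \<inter> E" using \<phi>(2) x ME by auto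
      then show ?thesis unfolding U_ball by (simp add: commute)
    qed
    then show ?thesis using \<phi>(1) by (intro exI[of _ \<phi>]) simp
  qed
  from choice[OF allI, OF approximation] obtain \<phi> where
    "\<forall>n. sigma_locally_constant X M (\<phi> n) \<and> (\<forall>x\<in>E. d x (\<phi> n x) < (1/2)^(n+2))" ..
  then have \<phi>: "\<And>n. sigma_locally_constant X M (\<phi> n)"
    "\<And>n x. x \<in> E \<Longrightarrow> d x (\<phi> n x) < (1/2)^(n+2)"
    by simp_all
  \<comment> \<open>\<open>h n\<close> receives the proposed new value \<open>y\<close> and the previous value \<open>z\<close>.\<close>
  define h where "h n = (\<lambda>(y, z). if d z y \<le> (1/2)^n then y else z)" for n :: nat
  define \<psi> where "\<psi> = rec_nat (\<phi> 0) (\<lambda>n p x. h n (\<phi> (Suc n) x, p x))"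
  have \<psi>_simps: "\<psi> 0 = \<phi> 0" "\<And>n. \<psi> (Suc n) = (\<lambda>x. h n (\<phi> (Suc n) x, \<psi> n x))"
    by (simp_all add: \<psi>_def)
  have \<psi>: "sigma_locally_constant X M (\<psi> n)" for n
  proof (induction n)
    case 0
    then show ?case using \<phi>(1) \<psi>_simps by simp
  next
    case (Suc n)
    have "h n \<in> M \<times> M \<rightarrow> M" by (auto simp: h_def)
    from sigma_locally_constant_compose[OF sigma_locally_constant_Pair[OF \<phi>(1) Suc] this]
    show ?case unfolding \<psi>_simps .
  qed
  have "d (\<psi> n x) (\<psi> (Suc n) x) \<le> (1/2)^n" if "x \<in> topspace X" for n x
    using sigma_locally_constant_in[OF \<psi>[of n] that] unfolding \<psi>_simps h_def by auto
  from uniform_limit_Lebesgue_class_one[OF complete \<psi> this]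
  obtain r where r: "r \<in> Lebesgue_class_one X mtopology"
    "\<forall>x\<in>topspace X. limitin mtopology (\<lambda>n. \<psi> n x) (r x) sequentially" ..
  \<comment> \<open>On \<open>E\<close> no proposal is ever rejected: consecutive values differ by less than
    \<open>(1/4 + 1/8) * (1/2)^n\<close>, which is why the balls have radius \<open>(1/2)^(n+2)\<close>.\<close>
  have \<psi>_eq: "\<psi> n x = \<phi> n x" if x: "x \<in> E" for n x
  proof (induction n)
    case 0
    then show ?case by (simp add: \<psi>_simps)
  next
    case (Suc n)
    have "\<phi> m x \<in> M" for m
      using sigma_locally_constant_in[OF \<phi>(1)] x assms(4) by blast
    then have "d (\<phi> n x) (\<phi> (Suc n) x) \<le> d x (\<phi> n x) + d x (\<phi> (Suc n) x)"
      using triangle[of "\<phi> n x" x "\<phi> (Suc n) x"] x ME by (simp add: commute)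
    also have "\<dots> \<le> (1/2)^(n+2) + (1/2)^(Suc n+2)"
      using \<phi>(2)[OF x, of n] \<phi>(2)[OF x, of "Suc n"] by linarith
    also have "\<dots> \<le> (1/2)^n" by simp
    finally show ?case using Suc by (simp add: \<psi>_simps h_def)
  qed
  have "r x = x" if x: "x \<in> E" for x
  proof -
    have "(\<lambda>n. (1/2::real)^n * (1/4)) \<longlonglongrightarrow> 0 * (1/4)"
      by (intro tendsto_mult_right LIMSEQ_power_zero) auto
    then have lim0: "(\<lambda>n. (1/2::real)^(n+2)) \<longlonglongrightarrow> 0"
      by (simp add: power_add power2_eq_square)
    have "limitin mtopology (\<lambda>n. \<psi> n x) x sequentially"
      unfolding limitin_metric
    proof (intro conjI allI impI)
      show "x \<in> M" using x ME by simp
      fix \<epsilon> :: real assume "\<epsilon> > 0"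
      from order_tendstoD(2)[OF lim0 this]
      show "\<forall>\<^sub>F n in sequentially. \<psi> n x \<in> M \<and> d (\<psi> n x) x < \<epsilon>"
      proof eventually_elim
        case (elim n)
        then show ?case
          using \<phi>(2)[OF x, of n] \<psi>_eq[OF x, of n] sigma_locally_constant_in[OF \<psi>[of n], of x] x assms(4)
          by (auto simp: commute)
      qed
    qed
    then show ?thesis
      using r(2) x assms(4) limitin_metric_unique trivial_limit_sequentially by (meson subsetD)
  qed
  then show ?thesis
    unfolding H1_retract_of_def top using r(1) assms(4) by (intro conjI bexI[of _ r]) auto
qed

end
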